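(* Let $\mathcal{D}$ be a normal and neutral domain, let $m$ be the number of alternatives, let $0<\varepsilon_a<1$ and $0<\delta<1/2$. If $\mathrm{con}_{\mathcal{D}}(\lceil(1-\varepsilon_a)m\rceil)=1$, then there does not exist any $(0,\varepsilon_a,\delta,\mathcal{D})$-Arbitrary Outliers vs Random Profile Tester.
   Context: Profiles and domains. Let $\mathcal{A}$ be a finite set of $m$ alternatives and $\mathcal{L}(\mathcal{A})$ the set of linear orders (preferences) over $\mathcal{A}$; for $\mathcal{X}\subseteq\mathcal{A}$, $\succ(\mathcal{X})$ is the restriction of $\succ$ to $\mathcal{X}$. A profile is a tuple $(\succ_i)_{i\in[n]}$ of $n$ preferences over $\mathcal{A}$, one per agent. A domain $\mathcal{D}$ is a collection of subsets of $\bigcup_{|\mathcal{A}|>0}\mathcal{L}(\mathcal{A})$; a profile $\mathcal{P}$ of $n$ preferences belongs to $\mathcal{D}$ (written $\mathcal{P}\in\mathcal{D}$) if there is $\mathcal{B}\in\mathcal{D}$ with $\mathcal{P}\in\mathcal{B}^n$. $\mathcal{D}$ is neutral if membership of profiles in $\mathcal{D}$ is preserved under renaming the alternatives (the same renaming for all preferences of the profile). $\mathcal{D}$ is normal if $(\succ_i)_{i\in[n]}\in\mathcal{D}$ implies $(\succ_i(\mathcal{X}))_{i\in[n]}\in\mathcal{D}$ for every $\mathcal{X}\subseteq\mathcal{A}$. The content of $\mathcal{D}$ is the function $\mathrm{con}_{\mathcal{D}}:\mathbb{N}\to[0,1]$ such that $\mathrm{con}_{\mathcal{D}}(k)\,k!$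 is the maximum number of distinct preferences in a profile over $k$ alternatives belonging to $\mathcal{D}$ (it is assumed that $\mathrm{con}_{\mathcal{D}}(1)=1$, i.e. profiles over one alternative belong to $\mathcal{D}$). Sampling model. An oracle, when queried, returns an agent picked uniformly at random with replacement from the set of all $n$ agents. The algorithm may then ask this agent arbitrarily many comparison queries: given two alternatives $x,y$, the agent replies which of the two it prefers. Problem. A $(0,\varepsilon_a,\delta,\mathcal{D})$-Arbitrary Outliers vs Random Profile Tester is a (randomized) algorithm in this model which, given a profile $(\succ_i)_{i\in[n]}$ over $\mathcal{A}$ that is of one of the following two kinds, outputs $1$ if it is of kind (i) and $0$ if it is of kind (ii), with error probability at most $\delta$: (i) there exists $\mathcal{X}\subseteq\mathcal{A}$ with $|\mathcal{X}|\ge(1-\varepsilon_a)m$ such that $(\succ_i(\mathcal{X}))_{i\in[n]}\in\mathcal{D}$; (ii) for every $i\in[n]$, $\succ_i$ is distributed (independently) uniformly in $\mathcal{L}(\mathcal{A})$. The error probability is over the randomness generating the instance in (ii) and the randomness of the algorithm (including the oracle). *)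

theory Defs
  imports "HOL-Probability.Probability" "HOL-Probability.SPMF" "HOL-Probability.Product_PMF"
begin

text \<open>
  A preference over \<open>A\<close> is a reflexive linear order \<open>r\<close> on \<open>A\<close>; \<open>(x, y) \<in> r\<close> means that \<open>x\<close> is
  ranked at least as high as \<open>y\<close>. With reflexive orders \<open>A\<close> can be recovered from \<open>r\<close>, also when
  it is a singleton.
\<close>

definition preferences :: "'a set \<Rightarrow> 'a rel set" where
  "preferences A = {r. linear_order_on A r}"

text \<open>The agents are \<open>{1..n}\<close>; the values of \<open>P\<close> at other indices are irrelevant.\<close>

definition profile :: "'a set \<Rightarrow> nat \<Rightarrow> (nat \<Rightarrow> 'a rel) \<Rightarrow> bool" where
  "profile A n P \<longleftrightarrow> finite A \<and> A \<noteq> {} \<and> (\<forall>i\<in>{1..n}. P i \<in> preferences A)"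

definition domain :: "'a rel set set \<Rightarrow> bool" where
  "domain D \<longleftrightarrow> (\<forall>B\<in>D. B \<subseteq> (\<Union>A\<in>{A. finite A \<and> A \<noteq> {}}. preferences A))"

definition in_domain :: "'a rel set set \<Rightarrow> nat \<Rightarrow> (nat \<Rightarrow> 'a rel) \<Rightarrow> bool" where
  "in_domain D n P \<longleftrightarrow> (\<exists>B\<in>D. \<forall>i\<in>{1..n}. P i \<in> B)"

definition neutral :: "'a rel set set \<Rightarrow> bool" where
  "neutral D \<longleftrightarrow> (\<forall>A n P f. profile A n P \<and> in_domain D n P \<and> inj_on f A \<longrightarrow>
     in_domain D n (\<lambda>i. map_prod f f ` P i))"

text \<open>
  Restrictions to the empty set are excluded: the members of a domain only contain preferences over
  nonempty sets of alternatives.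
\<close>

definition normal :: "'a rel set set \<Rightarrow> bool" where
  "normal D \<longleftrightarrow> (\<forall>A n P X. profile A n P \<and> in_domain D n P \<and> X \<subseteq> A \<and> X \<noteq> {} \<longrightarrow>
     in_domain D n (\<lambda>i. Restr (P i) X))"

text \<open>
  The set below is bounded by \<open>fact k\<close>, so \<open>Sup\<close> is its maximum, and \<open>0\<close> if it is empty.
\<close>

definition domain_content :: "'a rel set set \<Rightarrow> nat \<Rightarrow> real" where
  "domain_content D k =
     real (Sup {card (P ` {1..n}) |A n P. card A = k \<and> profile A n P \<and> in_domain D n P}) / fact k"

text \<open>
  Randomized algorithms with oracle access to a profile, as possibly infinite decision trees, so that
  neither the number of queries nor the running time is bounded. \<open>Random\<close> is the internal randomness,
  \<open>Draw\<close> queries the oracle for an agent, and \<open>Compare i x y\<close> asks agent \<open>i\<close> whether it prefers \<open>x\<close>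
  to \<open>y\<close>. The branch taken may depend on all answers received so far.
\<close>

codatatype 'a algorithm =
    Output bool
  | Random "nat pmf" "nat \<Rightarrow> 'a algorithm"
  | Draw "nat \<Rightarrow> 'a algorithm"
  | Compare nat 'a 'a "bool \<Rightarrow> 'a algorithm"

text \<open>
  \<open>S\<close> is the set of agents that the oracle has returned so far; only these can be asked, and asking
  any other agent aborts. The missing probability mass of the result is the probability that the
  algorithm aborts or runs forever.
\<close>

partial_function (spmf) run ::
  "nat \<Rightarrow> (nat \<Rightarrow> 'a rel) \<Rightarrow> nat set \<Rightarrow> 'a algorithm \<Rightarrow> bool spmf" where
  "run n P S T = (case T of
     Output b \<Rightarrow> return_spmf b
   | Random p k \<Rightarrow> bind_spmf (spmf_of_pmf p) (\<lambda>j. run n P S (k j))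
   | Draw k \<Rightarrow> bind_spmf (spmf_of_set {1..n}) (\<lambda>i. run n P (insert i S) (k i))
   | Compare i x y k \<Rightarrow>
       if i \<in> S then run n P S (k ((x, y) \<in> P i)) else return_pmf None)"

definition random_profile :: "'a set \<Rightarrow> nat \<Rightarrow> (nat \<Rightarrow> 'a rel) pmf" where
  "random_profile A n = Pi_pmf {1..n} {} (\<lambda>_. pmf_of_set (preferences A))"

text \<open>
  A \<open>(0, \<epsilon>, \<delta>, D)\<close>-Arbitrary Outliers vs Random Profile Tester for \<open>n\<close> agents and the set \<open>A\<close> of
  alternatives. \<open>Some True\<close> is output 1, \<open>Some False\<close> is output 0, and \<open>None\<close> (no output) always
  counts as an error.
\<close>

definition outliers_vs_random_tester ::
  "real \<Rightarrow> real \<Rightarrow> 'a rel set set \<Rightarrow> 'a set \<Rightarrow> nat \<Rightarrow> 'a algorithm \<Rightarrow> bool" where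
  "outliers_vs_random_tester \<epsilon> \<delta> D A n T \<longleftrightarrow>
     (\<forall>P. profile A n P \<and>
        (\<exists>X\<subseteq>A. real (card X) \<ge> (1 - \<epsilon>) * real (card A) \<and> in_domain D n (\<lambda>i. Restr (P i) X)) \<longrightarrow>
        measure_pmf.prob (run n P {} T) {b. b \<noteq> Some True} \<le> \<delta>) \<and>
     measure_pmf.prob (random_profile A n \<bind> (\<lambda>P. run n P {} T)) {b. b \<noteq> Some False} \<le> \<delta>"

end

theory Submission
  imports Defs
begin

text \<open>
  If the content at \<open>k = \<lceil>(1 - \<epsilon>) m\<rceil>\<close> is 1, then some set in \<open>D\<close> contains all preferences over
  some set of \<open>k\<close> alternatives, and by neutrality the same holds for every set of \<open>k\<close> alternatives.
  Hence every profile is of kind (i), in particular every outcome of the random profile. On the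
  random profile a tester would thus have to answer both 0 and 1 with probability
  at least \<open>1 - \<delta> > 1 / 2\<close>.
\<close>

lemma preferences_nonempty: "preferences A \<noteq> {}"
  using well_order_on[of A] by (auto simp: preferences_def well_order_on_def)

lemma preferences_subset: "r \<in> preferences A \<Longrightarrow> r \<subseteq> A \<times> A"
  by (auto simp: preferences_def linear_order_on_def partial_order_on_def preorder_on_def
      refl_on_def)

lemma finite_preferences: "finite A \<Longrightarrow> finite (preferences A)"
  by (rule finite_subset[of _ "Pow (A \<times> A)"]) (use preferences_subset in auto)

lemma Restr_preferences:
  "r \<in> preferences A \<Longrightarrow> X \<subseteq> A \<Longrightarrow> Restr r X \<in> preferences X"
  unfolding preferences_def linear_order_on_def partial_order_on_def preorder_on_def
  by (auto simp: refl_on_def total_on_def antisym_def subset_eq intro!: trans_Restr)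

text \<open>Supplies the element that the counting bound below splits off. As
  \<open>(x, a) \<in> r\<close> means that \<open>x\<close> is ranked at least as high as
  \<open>a\<close>, it is the alternative ranked last.\<close>

lemma preferences_greatest:
  assumes "finite A" "A \<noteq> {}" "r \<in> preferences A"
  obtains a where "a \<in> A" "\<And>x. x \<in> A \<Longrightarrow> (x, a) \<in> r"
proof -
  have r: "refl_on A r" "trans r" "total_on A r"
    using assms(3)
    by (auto simp: preferences_def linear_order_on_def partial_order_on_def preorder_on_def)
  \<comment> \<open>Stated for all nonempty subsets \<open>B\<close> of \<open>A\<close>, so that
    \<open>r\<close> stays an order on the fixed set \<open>A\<close> while the induction adds
    elements to \<open>B\<close>.\<close>
  have "\<exists>a\<in>B. \<forall>x\<in>B. (x, a) \<in> r" if "finite B" "B \<noteq> {}" "B \<subseteq> A" for B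
    using that
  proof (induction B rule: finite_ne_induct)
    case (singleton x)
    then show ?case using r(1) by (auto simp: refl_on_def)
  next
    case (insert x F)
    then obtain a where a: "a \<in> F" "\<forall>y\<in>F. (y, a) \<in> r" by auto
    have "x \<in> A" "a \<in> A" "x \<noteq> a" using a(1) insert.prems insert.hyps by auto
    then have "(x, a) \<in> r \<or> (a, x) \<in> r" "(x, x) \<in> r"
      using r(1,3) by (simp_all add: total_on_def refl_on_def)
    moreover have "(y, x) \<in> r" if "(a, x) \<in> r" "y \<in> F" for y
      using a(2) r(2) that by (blast dest: transD)
    ultimately show ?case using a by auto
  qed
  from this[OF assms(1,2) order_refl] show thesis using that by blast
qed

text \<open>
  A preference is determined by its greatest element \<open>a\<close> and its restriction to \<open>A - {a}\<close>.
\<close>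

lemma card_preferences_le:
  assumes "finite A"
  shows "card (preferences A) \<le> fact (card A)"
  using assms
proof (induction "card A" arbitrary: A)
  case 0
  then have "preferences A \<subseteq> {{}}" using preferences_subset by fastforce
  then show ?case using card_mono[of "{{}}" "preferences A"] 0 by simp
next
  case (Suc k)
  let ?S = "SIGMA a:A. preferences (A - {a})"
  have "preferences A \<subseteq> (\<lambda>(a, s). s \<union> A \<times> {a}) ` ?S"
  proof
    fix r assume r: "r \<in> preferences A"
    have "A \<noteq> {}" using Suc.hyps(2) by auto
    with Suc.prems r obtain a where a: "a \<in> A" "\<And>x. x \<in> A \<Longrightarrow> (x, a) \<in> r"
      using preferences_greatest by blast
    have anti: "antisym r"
      using r by (simp add: preferences_def linear_order_on_def partial_order_on_def)
    \<comment> \<open>By antisymmetry, the pairs of \<open>r\<close> that involve \<open>a\<close>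
      are exactly those in \<open>A \<times> {a}\<close>.\<close>
    have "r = Restr r (A - {a}) \<union> A \<times> {a}"
      using preferences_subset[OF r] a anti unfolding antisym_def by blast
    moreover have "Restr r (A - {a}) \<in> preferences (A - {a})"
      using r by (rule Restr_preferences) auto
    ultimately show "r \<in> (\<lambda>(a, s). s \<union> A \<times> {a}) ` ?S"
      using a(1) by (intro image_eqI[of _ _ "(a, Restr r (A - {a}))"]) auto
  qed
  then have "card (preferences A) \<le> card ?S"
    using Suc.prems by (intro surj_card_le) (auto intro: finite_preferences)
  also have "\<dots> = (\<Sum>a\<in>A. card (preferences (A - {a})))"
    using Suc.prems by (intro card_SigmaI) (auto intro: finite_preferences)
  also have "\<dots> \<le> (\<Sum>a\<in>A. fact k)"
  proof (rule sum_mono)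
    fix a assume "a \<in> A"
    with Suc.hyps(2) Suc.prems have "k = card (A - {a})" by simp
    with Suc.hyps(1) Suc.prems show "card (preferences (A - {a})) \<le> fact k" by blast
  qed
  also have "\<dots> = fact (card A)" using Suc.hyps(2)[symmetric] by simp
  finally show ?case .
qed

lemma map_prod_preferences:
  assumes "r \<in> preferences A" "inj_on f A"
  shows "map_prod f f ` r \<in> preferences (f ` A)"
proof -
  note sub = preferences_subset[OF assms(1)]
  have r: "refl_on A r" "trans r" "antisym r" "total_on A r"
    using assms(1)
    by (auto simp: preferences_def linear_order_on_def partial_order_on_def preorder_on_def)
  \<comment> \<open>Injectivity makes \<open>f\<close> an order isomorphism onto its image; each
    order axiom is then transferred through this equivalence.\<close>
  have iff: "(f x, f y) \<in> map_prod f f ` r \<longleftrightarrow> (x, y) \<in> r" if "x \<in> A" "y \<in> A" for x y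
  proof
    assume "(f x, f y) \<in> map_prod f f ` r"
    then obtain a b where ab: "(a, b) \<in> r" "f x = f a" "f y = f b" by auto
    with sub that assms(2) have "x = a" "y = b" by (auto dest: inj_onD)
    with ab(1) show "(x, y) \<in> r" by simp
  qed (auto intro: rev_image_eqI)
  have img: "map_prod f f ` r \<subseteq> f ` A \<times> f ` A" using sub by auto
  have "refl_on (f ` A) (map_prod f f ` r)"
    using r(1) iff by (auto simp: refl_on_def)
  moreover have "trans (map_prod f f ` r)"
  proof (rule transI)
    fix x y z
    assume h: "(x, y) \<in> map_prod f f ` r" "(y, z) \<in> map_prod f f ` r"
    with img obtain a b c where "x = f a" "y = f b" "z = f c" "a \<in> A" "b \<in> A" "c \<in> A"
      by blast
    with h show "(x, z) \<in> map_prod f f ` r" using iff r(2) unfolding trans_def by metis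
  qed
  moreover have "antisym (map_prod f f ` r)"
  proof (rule antisymI)
    fix x y
    assume h: "(x, y) \<in> map_prod f f ` r" "(y, x) \<in> map_prod f f ` r"
    with img obtain a b where "x = f a" "y = f b" "a \<in> A" "b \<in> A" by blast
    with h show "x = y" using iff r(3) unfolding antisym_def by metis
  qed
  moreover have "total_on (f ` A) (map_prod f f ` r)"
    using r(4) iff by (auto simp: total_on_def)
  ultimately show ?thesis
    using img
    by (simp add: preferences_def linear_order_on_def partial_order_on_def preorder_on_def)
qed

text \<open>The supremum is attained, so some profile in the domain has \<open>fact k\<close>
  distinct preferences; as at most that many preferences over \<open>A\<close> exist, it contains
  all of them.\<close>

lemma domain_content_eq_1D:
  fixes D :: "'a rel set set"
  assumes "domain_content D k = 1"
  obtains A n P where "card A = k" "profile A n P" "in_domain D n P"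
    "P ` {1..n} = preferences A"
proof -
  let ?S = "{card (P ` {1..n}) |A n P. card A = k \<and> profile A n P \<and> in_domain D n P}"
  have bound: "card (P ` {1..n}) \<le> card (preferences A)"
    if "profile A n P" for A :: "'a set" and n P
    using that by (intro card_mono) (auto simp: profile_def intro: finite_preferences)
  have "?S \<subseteq> {..fact k}"
  proof
    fix c assume "c \<in> ?S"
    then obtain A :: "'a set" and n P
      where *: "c = card (P ` {1..n})" "card A = k" "profile A n P"
      by blast
    then have "card (preferences A) \<le> fact k"
      using card_preferences_le[of A] by (simp add: profile_def)
    with bound[OF *(3)] *(1) show "c \<in> {..fact k}" by simp
  qed
  then have fin: "finite ?S" by (rule finite_subset) simp
  have "real (Sup ?S) = real (fact k)"
    using assms by (simp add: domain_content_def)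
  then have Sup: "Sup ?S = fact k" by (rule of_nat_eq_iff[THEN iffD1])
  \<comment> \<open>On naturals, \<open>Sup\<close> is \<open>Max\<close> except on the empty set,
    where it defaults to 0; this differs from \<open>fact k\<close>, which is positive.\<close>
  have "?S \<noteq> {}"
  proof
    assume "?S = {}"
    then have "Sup ?S = 0" by (simp only: Sup_nat_empty)
    with Sup show False by simp
  qed
  with fin have "Max ?S \<in> ?S" by (rule Max_in)
  with \<open>?S \<noteq> {}\<close> have "Sup ?S \<in> ?S" by (simp only: Sup_nat_def if_False)
  then have "fact k \<in> ?S" by (simp only: Sup)
  then obtain A n P
    where *: "card A = k" "profile A n P" "in_domain D n P" "fact k = card (P ` {1..n})"
    by blast
  have "P ` {1..n} = preferences A"
  proof (rule card_seteq)
    show "finite (preferences A)" using *(2) by (simp add: profile_def finite_preferences)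
    show "P ` {1..n} \<subseteq> preferences A" using *(2) by (auto simp: profile_def)
    show "card (preferences A) \<le> card (P ` {1..n})"
      using * card_preferences_le[of A] by (simp add: profile_def)
  qed
  with *(1-3) show thesis by (rule that)
qed

text \<open>Neutrality carries a profile with all preferences over some \<open>Y\<close> to one with
  all preferences over \<open>X\<close>. A single \<open>B\<close> in \<open>D\<close> covers the
  latter, hence every profile over \<open>X\<close>, whatever its number of agents.\<close>

lemma in_domain_if_domain_content_eq_1:
  assumes "neutral D" "domain_content D (card X) = 1" "finite X"
    and P: "\<And>i. i \<in> {1..n} \<Longrightarrow> P i \<in> preferences X"
  shows "in_domain D n P"
proof -
  obtain Y l Q where Q: "card Y = card X" "profile Y l Q" "in_domain D l Q"
    "Q ` {1..l} = preferences Y"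
    using domain_content_eq_1D assms(2) by blast
  from Q(2) have "finite Y" by (simp add: profile_def)
  with Q(1) \<open>finite X\<close> obtain f where f: "bij_betw f Y X"
    using finite_same_card_bij by blast
  then have "in_domain D l (\<lambda>i. map_prod f f ` Q i)"
    using assms(1) Q unfolding neutral_def bij_betw_def by blast
  then obtain B where B: "B \<in> D" "\<And>i. i \<in> {1..l} \<Longrightarrow> map_prod f f ` Q i \<in> B"
    unfolding in_domain_def by blast
  have "r \<in> B" if r: "r \<in> preferences X" for r
  proof -
    let ?g = "the_inv_into Y f"
    have g: "bij_betw ?g X Y" using f by (rule bij_betw_the_inv_into)
    \<comment> \<open>Pulling \<open>r\<close> back along the inverse of \<open>f\<close> gives a
      preference over \<open>Y\<close>, held by some agent of \<open>Q\<close>; renaming it by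
      \<open>f\<close> recovers \<open>r\<close>.\<close>
    then have "map_prod ?g ?g ` r \<in> preferences Y"
      using map_prod_preferences[OF r] by (metis bij_betw_def)
    with Q(4) obtain i where i: "i \<in> {1..l}" "Q i = map_prod ?g ?g ` r" by (metis imageE)
    have "map_prod f f ` map_prod ?g ?g ` r = (\<lambda>p. p) ` r"
      unfolding image_image using preferences_subset[OF r] f
      by (intro image_cong) (auto simp: f_the_inv_into_f_bij_betw)
    with B(2)[OF i(1)] i(2) show ?thesis by simp
  qed
  with B(1) P show ?thesis unfolding in_domain_def by blast
qed

lemma random_profile_profile:
  assumes "finite A" "A \<noteq> {}" "P \<in> set_pmf (random_profile A n)"
  shows "profile A n P"
  using assms
  by (auto simp: random_profile_def profile_def set_Pi_pmf PiE_dflt_def finite_preferences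
      preferences_nonempty)

text \<open>A mixture of distributions cannot exceed a bound that holds for each component. It turns
  the error bound for every fixed profile into one for the random profile.\<close>

lemma prob_bind_pmf_le:
  assumes "\<And>x. x \<in> set_pmf p \<Longrightarrow> measure_pmf.prob (f x) B \<le> c"
  shows "measure_pmf.prob (p \<bind> f) B \<le> c"
proof -
  obtain x where "x \<in> set_pmf p" using set_pmf_not_empty by fastforce
  then have c: "0 \<le> c" using assms measure_nonneg order_trans by metis
  have "emeasure (measure_pmf (p \<bind> f)) B = (\<integral>\<^sup>+x. emeasure (f x) B \<partial>p)" by (rule emeasure_bind_pmf)
  also have "\<dots> \<le> (\<integral>\<^sup>+x. ennreal c \<partial>p)"
    by (intro nn_integral_mono_AE)
      (auto simp: AE_measure_pmf_iff measure_pmf.emeasure_eq_measure intro!: ennreal_leI assms)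
  also have "\<dots> = ennreal c" by simp
  finally show ?thesis using c by (simp add: measure_pmf.emeasure_eq_measure)
qed

theorem proposition3p12:
  fixes D :: "'a rel set set" and A :: "'a set" and m n :: nat and \<epsilon>\<^sub>a \<delta> :: real
  assumes "domain D" and "domain_content D 1 = 1"
    and "normal D" and "neutral D"
    and "finite A" and "card A = m" and "m > 0" and "n > 0"
    and "0 < \<epsilon>\<^sub>a" and "\<epsilon>\<^sub>a < 1" and "0 < \<delta>" and "\<delta> < 1 / 2"
    and "domain_content D (nat \<lceil>(1 - \<epsilon>\<^sub>a) * real m\<rceil>) = 1"
  shows "\<not> (\<exists>T. outliers_vs_random_tester \<epsilon>\<^sub>a \<delta> D A n T)"
proof
  assume "\<exists>T. outliers_vs_random_tester \<epsilon>\<^sub>a \<delta> D A n T"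
  then obtain T where T: "outliers_vs_random_tester \<epsilon>\<^sub>a \<delta> D A n T" ..
  let ?k = "nat \<lceil>(1 - \<epsilon>\<^sub>a) * real m\<rceil>"
  have "(1 - \<epsilon>\<^sub>a) * real m \<le> real m"
    using \<open>0 < \<epsilon>\<^sub>a\<close> by (simp add: mult_left_le_one_le algebra_simps)
  then have "?k \<le> card A" using \<open>card A = m\<close> by (simp add: ceiling_le_iff)
  \<comment> \<open>\<open>X\<close> is chosen before any profile: the same set witnesses kind (i)
    for all of them.\<close>
  then obtain X where X: "X \<subseteq> A" "card X = ?k"
    by (meson obtain_subset_with_card_n)
  have "finite X" using X(1) \<open>finite A\<close> finite_subset by blast
  have "(1 - \<epsilon>\<^sub>a) * real (card A) \<le> real (card X)"
    using X(2) \<open>card A = m\<close> by (simp add: real_nat_ceiling_ge)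
  moreover have "in_domain D n (\<lambda>i. Restr (P i) X)" if "profile A n P" for P
    using assms(4,13) X \<open>finite X\<close> that
    by (intro in_domain_if_domain_content_eq_1[of D X])
      (auto simp: profile_def intro: Restr_preferences)
  ultimately have error1: "measure_pmf.prob (run n P {} T) {b. b \<noteq> Some True} \<le> \<delta>"
    if "profile A n P" for P
    using T that X(1) unfolding outliers_vs_random_tester_def by blast
  let ?R = "random_profile A n \<bind> (\<lambda>P. run n P {} T)"
  have "A \<noteq> {}" using \<open>card A = m\<close> \<open>m > 0\<close> by auto
  then have "measure_pmf.prob ?R {b. b \<noteq> Some True} \<le> \<delta>"
    using \<open>finite A\<close> by (intro prob_bind_pmf_le error1 random_profile_profile)
  moreover have "measure_pmf.prob ?R {b. b \<noteq> Some False} \<le> \<delta>"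
    using T unfolding outliers_vs_random_tester_def by blast
  \<comment> \<open>No outcome equals both \<open>Some True\<close> and \<open>Some False\<close>,
    so the two error events cover everything, including \<open>None\<close>; their total probability
    is at most 2 \<delta> < 1.\<close>
  moreover have "1 \<le> measure_pmf.prob ?R {b. b \<noteq> Some True}
      + measure_pmf.prob ?R {b. b \<noteq> Some False}"
  proof -
    have "{b. b \<noteq> Some True} \<union> {b. b \<noteq> Some False} = UNIV" by auto
    then show ?thesis
      using measure_Un_le[of "{b. b \<noteq> Some True}" "measure_pmf ?R" "{b. b \<noteq> Some False}"]
      by simp
  qed
  ultimately show False using \<open>\<delta> < 1 / 2\<close> by linarith
qed

end
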